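(* For every integer $n\ge 5$, $$\left\lfloor \frac{2n-5}{3}\right\rfloor \leq c_2(n, K_5^-)\leq \left\lfloor\frac{2n-2}{3}\right\rfloor.$$ In particular, $c_2(K_5^-)= \frac{2}{3}$.
   Context: A $3$-graph $G=(V,E)$ consists of a finite vertex set $V$ and a set $E$ of $3$-element subsets of $V$ (its edges). A copy of $F$ in $G$ is a (not necessarily induced) subgraph of $G$ isomorphic to $F$. The codegree $d(x,y)$ of a pair of distinct vertices is the number of edges containing both $x$ and $y$, and $\delta_2(G)$ is the minimum of $d(x,y)$ over all pairs of distinct vertices. $G$ has an $F$-covering if every vertex of $G$ lies in at least one copy of $F$ in $G$. For a $3$-graph $F$ with at least one edge and an integer $n\ge |V(F)|$, $$c_2(n,F)=\max\{\delta_2(G): |V(G)|=n \text{ and } G \text{ does not have an } F\text{-covering}\},$$ and $c_2(F)=\lim_{n\to\infty}\frac{c_2(n,F)}{n-2}$ (this limit exists). $K_5^-$ denotes the $3$-graph obtained from the complete $3$-graph on $5$ vertices by removing one edge. *)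

theory Defs
  imports Complex_Main "HOL-Library.Ramsey"
begin

record 'a hgraph =
  verts :: "'a set"
  edges :: "'a set set"

definition three_graph :: "'a hgraph \<Rightarrow> bool" where
  "three_graph G \<longleftrightarrow> finite (verts G) \<and> edges G \<subseteq> nsets (verts G) 3"

definition isomorphic :: "'a hgraph \<Rightarrow> 'b hgraph \<Rightarrow> bool" where
  "isomorphic F H \<longleftrightarrow>
     (\<exists>f. bij_betw f (verts F) (verts H) \<and> edges H = (\<lambda>e. f ` e) ` edges F)"

text \<open>Subgraphs need not be induced.\<close>

definition subgraph :: "'a hgraph \<Rightarrow> 'a hgraph \<Rightarrow> bool" where
  "subgraph H G \<longleftrightarrow> three_graph H \<and> verts H \<subseteq> verts G \<and> edges H \<subseteq> edges G"

definition has_covering :: "'a hgraph \<Rightarrow> 'b hgraph \<Rightarrow> bool" where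
  "has_covering G F \<longleftrightarrow>
     (\<forall>v \<in> verts G. \<exists>H. subgraph H G \<and> isomorphic F H \<and> v \<in> verts H)"

definition codegree :: "'a hgraph \<Rightarrow> 'a \<Rightarrow> 'a \<Rightarrow> nat" where
  "codegree G x y = card {e \<in> edges G. x \<in> e \<and> y \<in> e}"

definition min_codegree :: "'a hgraph \<Rightarrow> nat" where
  "min_codegree G = Min {codegree G x y | x y. x \<in> verts G \<and> y \<in> verts G \<and> x \<noteq> y}"

text \<open>
  The host graphs have natural numbers as vertices. This loses no generality: every finite
  3-graph is isomorphic to one of these, and the minimum codegree and the covering property are
  invariant under isomorphism. The maximum is meaningful when \<open>F\<close> has at least one edge and
  \<open>n \<ge> card (verts F)\<close>: the set is then finite, and it is nonempty because it contains the
  value of the edgeless graph.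
\<close>

definition cover_codegree :: "nat \<Rightarrow> 'b hgraph \<Rightarrow> nat" where
  "cover_codegree n F =
     Max {min_codegree G | G :: nat hgraph.
            three_graph G \<and> card (verts G) = n \<and> \<not> has_covering G F}"

definition cover_codegree_ratio :: "'b hgraph \<Rightarrow> nat \<Rightarrow> real" where
  "cover_codegree_ratio F n = real (cover_codegree n F) / (real n - 2)"

definition cover_threshold :: "'b hgraph \<Rightarrow> real" where
  "cover_threshold F = lim (cover_codegree_ratio F)"

definition K5_minus :: "nat hgraph" where
  "K5_minus = \<lparr>verts = {..<5}, edges = nsets {..<5} 3 - {{0, 1, 2}}\<rparr>"

end

theory Submission
  imports Defs "HOL-Real_Asymp.Real_Asymp"
begin

text \<open>
  Write \<open>n\<close> for the number of vertices and \<open>\<delta>\<close> for the minimum codegree.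

  \<^emph>\<open>Upper bound.\<close> If \<open>3\<delta> > 2n - 2\<close>, a copy of \<open>K\<^sub>5\<^sup>-\<close> can be grown around any vertex \<open>v\<close>,
  one vertex at a time. Suppose that all triples of a set \<open>S\<close> of \<open>s\<close> vertices are edges. Each of
  the \<open>s choose 2\<close> pairs in \<open>S\<close> forms an edge with at least \<open>\<delta> - (s - 2)\<close> of the \<open>n - s\<close> vertices
  outside \<open>S\<close>, so some outside vertex forms an edge with at least the average number of pairs
  (\<open>exists_vertex_joined_to_many_pairs\<close>). From \<open>s = 2\<close> and \<open>s = 3\<close> this average exceeds
  \<open>0\<close> and \<open>2\<close>, so the new vertex is joined to every pair and \<open>S\<close> stays complete. From
  \<open>s = 4\<close> it exceeds \<open>4\<close> exactly when \<open>6(\<delta> - 2) > 4(n - 4)\<close>, that is \<open>3\<delta> > 2n - 2\<close>; then at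
  least five of the six pairs are joined to the new vertex, and at most one triple of the five
  vertices is missing.

  \<^emph>\<open>Lower bound.\<close> Split the vertices other than \<open>v\<close> into three nearly equal classes. The
  edges are the triples \<open>vxy\<close> with \<open>x\<close> and \<open>y\<close> in different classes, and the triples without
  \<open>v\<close> that do not meet all three classes. Among any four vertices other than \<open>v\<close> two share a
  class, so together with \<open>v\<close> they form a missing triple. Either a second pair shares a class and
  gives a second missing triple through \<open>v\<close>, or deleting one of the two leaves a transversal
  triple, which is missing as well. So five vertices including \<open>v\<close> always miss two triples
  (\<open>uncovering_graph_not_covering\<close>). A pair fails to form edges only with one class and at
  most two further vertices, which leaves a codegree of about \<open>2n/3\<close>.

  Both bounds are \<open>2n/3 + O(1)\<close>, whence the limit.
\<close>

section \<open>Copies of \<open>K\<^sub>5\<^sup>-\<close> and codegrees\<close>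

text \<open>
  The complete 3-graph on five vertices is symmetric under all permutations, so the position of
  the missing triple is immaterial: a bijection onto the new vertex set only has to map
  \<open>{0,1,2}\<close> to that triple.
\<close>

lemma isomorphic_K5_minus_iff:
  "isomorphic K5_minus H \<longleftrightarrow>
     card (verts H) = 5 \<and> (\<exists>T \<in> nsets (verts H) 3. edges H = nsets (verts H) 3 - {T})"
proof
  assume "isomorphic K5_minus H"
  then obtain f where f: "bij_betw f {..<5::nat} (verts H)"
    and E: "edges H = (`) f ` (nsets {..<5} 3 - {{0,1,2}})"
    unfolding isomorphic_def K5_minus_def by auto
  have bij: "bij_betw ((`) f) (nsets {..<5} 3) (nsets (verts H) 3)"
    using bij_betw_nsets[OF f] .
  have T0: "{0,1,2} \<in> nsets {..<5::nat} 3"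
    by (auto simp: nsets_def)
  have "edges H = nsets (verts H) 3 - {f ` {0,1,2}}"
    unfolding E using bij T0
    by (subst inj_on_image_set_diff[of _ "nsets {..<5} 3"]) (auto simp: bij_betw_def)
  moreover have "f ` {0,1,2} \<in> nsets (verts H) 3"
    using bij T0 by (auto simp only: bij_betw_def)
  moreover have "card (verts H) = 5"
    using bij_betw_same_card[OF f] by simp
  ultimately show "card (verts H) = 5 \<and> (\<exists>T \<in> nsets (verts H) 3. edges H = nsets (verts H) 3 - {T})"
    by blast
next
  assume "card (verts H) = 5 \<and> (\<exists>T \<in> nsets (verts H) 3. edges H = nsets (verts H) 3 - {T})"
  then obtain T where card: "card (verts H) = 5" and T: "T \<in> nsets (verts H) 3"
    and E: "edges H = nsets (verts H) 3 - {T}" by blast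
  have finV: "finite (verts H)" using card by (simp add: card_ge_0_finite)
  have T': "T \<subseteq> verts H" "finite T" "card T = 3" using T by (auto simp: nsets_def)
  obtain g where g: "bij_betw g {..<3::nat} T"
    using finite_same_card_bij[of "{..<3::nat}" T] T' by auto
  have "card {3..<5::nat} = card (verts H - T)"
    using T' card by (simp add: card_Diff_subset)
  then obtain h where h: "bij_betw h {3..<5::nat} (verts H - T)"
    using finite_same_card_bij[of "{3..<5::nat}" "verts H - T"] finV by auto
  define f where "f = (\<lambda>i. if i < 3 then g i else h i)"
  have fg: "bij_betw f {..<3} T"
    using g by (rule bij_betw_cong[THEN iffD1, rotated]) (auto simp: f_def)
  have fh: "bij_betw f {3..<5} (verts H - T)"
    using h by (rule bij_betw_cong[THEN iffD1, rotated]) (auto simp: f_def)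
  have "bij_betw f ({..<3} \<union> {3..<5}) (T \<union> (verts H - T))"
    by (rule bij_betw_combine[OF fg fh]) auto
  moreover have "{..<3} \<union> {3..<5} = {..<5::nat}" by auto
  ultimately have f: "bij_betw f {..<5} (verts H)"
    using T' by (simp add: Un_absorb1)
  have bij: "bij_betw ((`) f) (nsets {..<5} 3) (nsets (verts H) 3)"
    using bij_betw_nsets[OF f] .
  have "{0,1,2} = {..<3::nat}" by auto
  then have fT: "f ` {0,1,2} = T"
    using fg by (simp add: bij_betw_def)
  have T0: "{0,1,2} \<in> nsets {..<5::nat} 3"
    by (auto simp: nsets_def)
  have "(`) f ` (nsets {..<5} 3 - {{0,1,2}}) = nsets (verts H) 3 - {f ` {0,1,2}}"
    using bij T0
    by (subst inj_on_image_set_diff[of _ "nsets {..<5} 3"]) (auto simp: bij_betw_def)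
  then have "edges H = (`) f ` edges K5_minus" by (simp only: E fT K5_minus_def hgraph.simps)
  moreover have "bij_betw f (verts K5_minus) (verts H)" using f by (simp add: K5_minus_def)
  ultimately show "isomorphic K5_minus H" unfolding isomorphic_def by blast
qed

lemma covered_by_K5_minus_iff:
  assumes "three_graph G"
  shows "(\<exists>H. subgraph H G \<and> isomorphic K5_minus H \<and> v \<in> verts H) \<longleftrightarrow>
     (\<exists>W T. W \<subseteq> verts G \<and> card W = 5 \<and> v \<in> W \<and> T \<in> nsets W 3 \<and> nsets W 3 - {T} \<subseteq> edges G)"
    (is "?L \<longleftrightarrow> ?R")
proof
  assume ?L
  then obtain H where H: "subgraph H G" "isomorphic K5_minus H" "v \<in> verts H" by blast
  then obtain T where T: "card (verts H) = 5" "T \<in> nsets (verts H) 3" "edges H = nsets (verts H) 3 - {T}"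
    by (auto simp only: isomorphic_K5_minus_iff)
  have "verts H \<subseteq> verts G" "nsets (verts H) 3 - {T} \<subseteq> edges G"
    using H(1) T(3) by (simp_all only: subgraph_def)
  then show ?R using H(3) T(1,2) by (intro exI[of _ "verts H"] exI[of _ T]) simp
next
  assume ?R
  then obtain W T where W: "W \<subseteq> verts G" "card W = 5" "v \<in> W" "T \<in> nsets W 3"
    "nsets W 3 - {T} \<subseteq> edges G" by blast
  define H where "H = \<lparr>verts = W, edges = nsets W 3 - {T}\<rparr>"
  have "finite W" using W(2) by (simp add: card_ge_0_finite)
  then have "subgraph H G"
    using W by (simp add: subgraph_def three_graph_def H_def)
  moreover have "isomorphic K5_minus H"
    unfolding isomorphic_K5_minus_iff using W by (auto simp: H_def)
  moreover have "v \<in> verts H" using W(3) by (simp add: H_def)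
  ultimately show ?L by blast
qed

text \<open>
  The vertex that extends a pair to an edge is recorded instead of the edge. The pair is given as a
  set, so that sums over all pairs inside a vertex set range over \<open>nsets S 2\<close>.
\<close>

definition coneighbours :: "'a hgraph \<Rightarrow> 'a set \<Rightarrow> 'a set" where
  "coneighbours G p = {z. insert z p \<in> edges G}"

lemma three_graph_edgeD:
  assumes "three_graph G" "e \<in> edges G"
  shows "e \<subseteq> verts G" "finite e" "card e = 3"
  using assms unfolding three_graph_def nsets_def by blast+

text \<open>
  A vertex of \<open>p\<close> itself is excluded because \<open>insert z p\<close> would then be \<open>p\<close>, which is too small
  to be an edge.
\<close>

lemma coneighbours_subset:
  assumes "three_graph G" "card p = 2"
  shows "coneighbours G p \<subseteq> verts G - p"
proof
  fix z assume "z \<in> coneighbours G p"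
  then have e: "insert z p \<in> edges G" by (simp add: coneighbours_def)
  have "insert z p \<noteq> p" using three_graph_edgeD(3)[OF assms(1) e] assms(2) by auto
  then show "z \<in> verts G - p" using three_graph_edgeD(1)[OF assms(1) e] by blast
qed

lemma codegree_eq_card_coneighbours:
  assumes G: "three_graph G" and "x \<noteq> y"
  shows "codegree G x y = card (coneighbours G {x,y})"
proof -
  have sub: "coneighbours G {x,y} \<subseteq> verts G - {x,y}"
    using coneighbours_subset[OF G, of "{x,y}"] \<open>x \<noteq> y\<close> by simp
  have "inj_on (\<lambda>z. insert z {x,y}) (coneighbours G {x,y})"
    using sub by (intro inj_onI) blast
  moreover have "(\<lambda>z. insert z {x,y}) ` coneighbours G {x,y} = {e \<in> edges G. x \<in> e \<and> y \<in> e}"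
  proof (intro equalityI subsetI)
    fix e assume "e \<in> {e \<in> edges G. x \<in> e \<and> y \<in> e}"
    then have e: "e \<in> edges G" "x \<in> e" "y \<in> e" by auto
    then have "finite e" "card e = 3" using three_graph_edgeD[OF G] by blast+
    then have "card (e - {x,y}) = 1" using e \<open>x \<noteq> y\<close> by (simp add: card_Diff_subset)
    then obtain z where "e - {x,y} = {z}" by (auto simp: card_1_singleton_iff)
    then have "e = insert z {x,y}" using e by blast
    then show "e \<in> (\<lambda>z. insert z {x,y}) ` coneighbours G {x,y}"
      using e(1) by (auto simp: coneighbours_def)
  qed (auto simp: coneighbours_def)
  ultimately show ?thesis unfolding codegree_def by (metis card_image)
qed

lemma finite_codegrees:
  assumes "finite (verts G)"
  shows "finite {codegree G x y | x y. x \<in> verts G \<and> y \<in> verts G \<and> x \<noteq> y}"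
proof -
  have "{codegree G x y | x y. x \<in> verts G \<and> y \<in> verts G \<and> x \<noteq> y}
        \<subseteq> (\<lambda>(x,y). codegree G x y) ` (verts G \<times> verts G)" by auto
  then show ?thesis by (rule finite_subset) (use assms in auto)
qed

lemma min_codegree_le:
  assumes "finite (verts G)" "x \<in> verts G" "y \<in> verts G" "x \<noteq> y"
  shows "min_codegree G \<le> codegree G x y"
  unfolding min_codegree_def by (rule Min_le[OF finite_codegrees]) (use assms in auto)

lemma min_codegree_ge:
  assumes "finite (verts G)" "card (verts G) \<ge> 2"
    and "\<And>x y. x \<in> verts G \<Longrightarrow> y \<in> verts G \<Longrightarrow> x \<noteq> y \<Longrightarrow> m \<le> codegree G x y"
  shows "m \<le> min_codegree G"
proof -
  obtain x y where "x \<in> verts G" "y \<in> verts G" "x \<noteq> y"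
    using assms(1,2) card_le_Suc0_iff_eq[of "verts G"] by fastforce
  then have "{codegree G x y | x y. x \<in> verts G \<and> y \<in> verts G \<and> x \<noteq> y} \<noteq> {}" by blast
  then show ?thesis unfolding min_codegree_def
    using assms(3) by (subst Min_ge_iff[OF finite_codegrees[OF assms(1)]]) auto
qed

section \<open>Large codegree forces a covering\<close>

text \<open>
  Averaging: counting the incidences between points and sets in two ways, a point that lies in the
  average number of sets or more must exist.
\<close>

lemma exists_point_in_many_sets:
  assumes U: "finite U" and I: "finite I" and A: "\<And>i. i \<in> I \<Longrightarrow> A i \<subseteq> U"
    and large: "k * card U < (\<Sum>i\<in>I. card (A i))"
  shows "\<exists>u\<in>U. k < card {i \<in> I. u \<in> A i}"
proof (rule ccontr)
  assume "\<not> ?thesis"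
  then have le: "card {i \<in> I. u \<in> A i} \<le> k" if "u \<in> U" for u
    using that by (meson not_le)
  have "(\<Sum>i\<in>I. card (A i)) = (\<Sum>i\<in>I. card {u \<in> U. u \<in> A i})"
    using A by (intro sum.cong refl arg_cong[of _ _ card]) blast
  also have "\<dots> = (\<Sum>u\<in>U. card {i \<in> I. u \<in> A i})"
    using U I by (intro sum_multicount_gen) auto
  also have "\<dots> \<le> card U * k"
    using sum_bounded_above[of U "\<lambda>u. card {i \<in> I. u \<in> A i}" k] le by simp
  finally show False using large by (simp add: mult.commute)
qed

text \<open>
  The engine of the upper bound: averaging applied to the coneighbours outside \<open>S\<close> of the pairs
  inside \<open>S\<close>. A pair loses at most the \<open>card S - 2\<close> other vertices of \<open>S\<close>, hence the
  factor \<open>\<delta> + 2 - card S\<close>.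
\<close>

lemma exists_vertex_joined_to_many_pairs:
  assumes G: "three_graph G" and S: "S \<subseteq> verts G"
    and large: "k * (card (verts G) - card S) < (card S choose 2) * (min_codegree G + 2 - card S)"
  shows "\<exists>d \<in> verts G - S. k < card {p \<in> nsets S 2. insert d p \<in> edges G}"
proof -
  have finV: "finite (verts G)" using G by (simp add: three_graph_def)
  have finS: "finite S" using S finV finite_subset by blast
  have sub: "coneighbours G p \<subseteq> verts G - p" if "p \<in> nsets S 2" for p
    using coneighbours_subset[OF G] that by (auto simp: nsets_def)
  have pair: "min_codegree G + 2 - card S \<le> card (coneighbours G p - S)" if p: "p \<in> nsets S 2" for p
  proof -
    have p': "p \<subseteq> S" "finite p" "card p = 2" using p by (auto simp: nsets_def)
    then obtain x y where xy: "p = {x,y}" "x \<noteq> y" by (auto simp: card_2_iff)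
    have "min_codegree G \<le> codegree G x y"
      by (rule min_codegree_le[OF finV]) (use xy p' S in auto)
    also have "\<dots> = card (coneighbours G p)"
      using codegree_eq_card_coneighbours[OF G xy(2)] xy(1) by simp
    also have "\<dots> \<le> card ((coneighbours G p - S) \<union> (S - p))"
      by (rule card_mono) (use sub[OF p] finV finS in \<open>auto intro: finite_subset\<close>)
    also have "\<dots> \<le> card (coneighbours G p - S) + card (S - p)" by (rule card_Un_le)
    also have "card (S - p) = card S - 2" using p' by (simp add: card_Diff_subset)
    finally have *: "min_codegree G \<le> card (coneighbours G p - S) + (card S - 2)" .
    have "2 \<le> card S" using p' finS card_mono by metis
    with * show ?thesis by linarith
  qed
  have "(card S choose 2) * (min_codegree G + 2 - card S)
        = (\<Sum>p\<in>nsets S 2. min_codegree G + 2 - card S)"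
    by simp
  also have "\<dots> \<le> (\<Sum>p\<in>nsets S 2. card (coneighbours G p - S))"
    using pair by (rule sum_mono)
  finally have big: "k * card (verts G - S) < (\<Sum>p\<in>nsets S 2. card (coneighbours G p - S))"
    using large S finS by (simp add: card_Diff_subset)
  have "\<exists>d\<in>verts G - S. k < card {p \<in> nsets S 2. d \<in> coneighbours G p - S}"
  proof (rule exists_point_in_many_sets[OF _ _ _ big])
    show "finite (verts G - S)" using finV by simp
    show "finite (nsets S 2)" using finS by (rule finite_imp_finite_nsets)
    show "coneighbours G p - S \<subseteq> verts G - S" if "p \<in> nsets S 2" for p using sub[OF that] by blast
  qed
  then obtain d where d: "d \<in> verts G - S" "k < card {p \<in> nsets S 2. d \<in> coneighbours G p - S}"
    by blast
  have "{p \<in> nsets S 2. d \<in> coneighbours G p - S} = {p \<in> nsets S 2. insert d p \<in> edges G}"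
    using d(1) by (auto simp: coneighbours_def)
  then show ?thesis using d by (intro bexI[of _ d]) simp_all
qed

lemma triples_of_insert:
  assumes "e \<in> nsets (insert d S) 3" "e \<notin> nsets S 3"
  shows "\<exists>p \<in> nsets S 2. e = insert d p"
proof (intro bexI)
  have e: "e \<subseteq> insert d S" "finite e" "card e = 3" using assms(1) unfolding nsets_def by blast+
  have d: "d \<in> e" using assms(2) e unfolding nsets_def by blast
  then show "e = insert d (e - {d})" by blast
  have "card (e - {d}) = 2" using d e by simp
  then show "e - {d} \<in> nsets S 2" using e unfolding nsets_def by blast
qed

lemma complete_triples_insert:
  assumes "finite S" "nsets S 3 \<subseteq> E"
    and "(card S choose 2) \<le> card {p \<in> nsets S 2. insert d p \<in> E}"
  shows "nsets (insert d S) 3 \<subseteq> E"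
proof -
  have all: "{p \<in> nsets S 2. insert d p \<in> E} = nsets S 2"
  proof (rule card_seteq)
    show "finite (nsets S 2)" using assms(1) by (rule finite_imp_finite_nsets)
    show "card (nsets S 2) \<le> card {p \<in> nsets S 2. insert d p \<in> E}" using assms(3) by simp
  qed blast
  show ?thesis
  proof
    fix e assume e: "e \<in> nsets (insert d S) 3"
    show "e \<in> E"
    proof (cases "e \<in> nsets S 3")
      case False
      then obtain p where "p \<in> nsets S 2" "e = insert d p" using triples_of_insert[OF e] by blast
      then show ?thesis using all by blast
    qed (use assms(2) in blast)
  qed
qed

text \<open>
  If every pair is joined to \<open>d\<close>, no triple is missing, but a copy of \<open>K\<^sub>5\<^sup>-\<close> still needs a
  triple \<open>T\<close> to omit; any pair then provides one, and \<open>2 \<le> card S\<close> guarantees that a pair exists.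
\<close>

lemma almost_complete_triples_insert:
  assumes S: "finite S" "2 \<le> card S" "d \<notin> S" "nsets S 3 \<subseteq> E"
    and many: "(card S choose 2) \<le> Suc (card {p \<in> nsets S 2. insert d p \<in> E})"
  shows "\<exists>T \<in> nsets (insert d S) 3. nsets (insert d S) 3 - {T} \<subseteq> E"
proof -
  define Q where "Q = {p \<in> nsets S 2. insert d p \<notin> E}"
  have fin: "finite (nsets S 2)" using S(1) by (simp add: finite_imp_finite_nsets)
  have "nsets S 2 - {p \<in> nsets S 2. insert d p \<in> E} = Q" by (auto simp: Q_def)
  then have "card Q = (card S choose 2) - card {p \<in> nsets S 2. insert d p \<in> E}"
    using card_Diff_subset[of "{p \<in> nsets S 2. insert d p \<in> E}" "nsets S 2"] fin by simp
  then have "card Q \<le> Suc 0" using many by linarith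
  then have uniq: "p = q" if "p \<in> Q" "q \<in> Q" for p q
    using that fin card_le_Suc0_iff_eq[of Q] by (auto simp: Q_def)
  obtain p0 where p0: "p0 \<in> nsets S 2" "\<And>p. p \<in> Q \<Longrightarrow> p = p0"
  proof (cases "Q = {}")
    case True
    have "nsets S 2 \<noteq> {}" using S(1,2) by (simp add: nsets_eq_empty_iff)
    then show ?thesis using that True by blast
  next
    case False
    then show ?thesis using that uniq by (auto simp: Q_def)
  qed
  have "p0 \<subseteq> S" "finite p0" "card p0 = 2" using p0(1) unfolding nsets_def by blast+
  moreover from this have "card (insert d p0) = 3" using S(3) by (subst card_insert_disjoint) auto
  ultimately have "insert d p0 \<in> nsets (insert d S) 3" unfolding nsets_def by blast
  moreover have "nsets (insert d S) 3 - {insert d p0} \<subseteq> E"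
  proof
    fix e assume e: "e \<in> nsets (insert d S) 3 - {insert d p0}"
    show "e \<in> E"
    proof (cases "e \<in> nsets S 3")
      case False
      then obtain p where p: "p \<in> nsets S 2" "e = insert d p" using e triples_of_insert[of e d S] by blast
      have "p \<noteq> p0" using e p(2) by blast
      then have "p \<notin> Q" using p0(2) by blast
      then show ?thesis using p unfolding Q_def by blast
    qed (use S(4) in blast)
  qed
  ultimately show ?thesis by blast
qed

text \<open>
  The sets \<open>S2\<close>, \<open>S3\<close>, \<open>S4\<close> are complete and contain \<open>v\<close>; the step to five vertices is the
  one that needs the full strength of the codegree hypothesis.
\<close>

theorem has_covering_if_large_min_codegree:
  assumes G: "three_graph G" and n: "card (verts G) \<ge> 4"
    and large: "2 * card (verts G) < 3 * min_codegree G + 2"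
  shows "has_covering G K5_minus"
  unfolding has_covering_def covered_by_K5_minus_iff[OF G]
proof
  fix v assume v: "v \<in> verts G"
  let ?E = "edges G" let ?n = "card (verts G)" let ?m = "min_codegree G"
  have finV: "finite (verts G)" using G by (simp add: three_graph_def)
  have choose: "(2::nat) choose 2 = 1" "(3::nat) choose 2 = 3" "(4::nat) choose 2 = 6"
    by (simp_all add: numeral_eq_Suc)
  have arith: "0 * (?n - 2) < 1 * (?m + 2 - 2)" "2 * (?n - 3) < 3 * (?m + 2 - 3)"
    "4 * (?n - 4) < 6 * (?m + 2 - 4)"
    using large n by linarith+
  have "verts G \<noteq> {v}" using n by auto
  then obtain a where a: "a \<in> verts G" "a \<noteq> v" using v by blast
  define S2 where "S2 = {v,a}"
  have S2: "S2 \<subseteq> verts G" "finite S2" "card S2 = 2" "nsets S2 3 \<subseteq> ?E"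
    using a v by (auto simp: S2_def nsets_eq_empty_iff nsets_def dest!: card_mono[rotated])
  obtain b where b: "b \<in> verts G - S2" "0 < card {p \<in> nsets S2 2. insert b p \<in> ?E}"
    using exists_vertex_joined_to_many_pairs[OF G S2(1), of 0] arith(1) unfolding S2(3) choose by auto
  define S3 where "S3 = insert b S2"
  have S3: "S3 \<subseteq> verts G" "finite S3" "card S3 = 3" "nsets S3 3 \<subseteq> ?E"
    using b S2 choose complete_triples_insert[OF S2(2,4), of b] by (auto simp: S3_def)
  obtain c where c: "c \<in> verts G - S3" "2 < card {p \<in> nsets S3 2. insert c p \<in> ?E}"
    using exists_vertex_joined_to_many_pairs[OF G S3(1), of 2] arith(2) unfolding S3(3) choose by auto
  define S4 where "S4 = insert c S3"
  have S4: "S4 \<subseteq> verts G" "finite S4" "card S4 = 4" "nsets S4 3 \<subseteq> ?E"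
    using c S3 choose complete_triples_insert[OF S3(2,4), of c] by (auto simp: S4_def)
  obtain d where d: "d \<in> verts G - S4" "4 < card {p \<in> nsets S4 2. insert d p \<in> ?E}"
    using exists_vertex_joined_to_many_pairs[OF G S4(1), of 4] arith(3) unfolding S4(3) choose by auto
  obtain T where T: "T \<in> nsets (insert d S4) 3" "nsets (insert d S4) 3 - {T} \<subseteq> ?E"
    using almost_complete_triples_insert[OF S4(2) _ _ S4(4), of d] S4(3) d choose by auto
  have "insert d S4 \<subseteq> verts G" "card (insert d S4) = 5" "v \<in> insert d S4"
    using d(1) S4(1-3) by (auto simp: S4_def S3_def S2_def)
  with T show "\<exists>W T. W \<subseteq> verts G \<and> card W = 5 \<and> v \<in> W \<and> T \<in> nsets W 3 \<and> nsets W 3 - {T} \<subseteq> ?E"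
    by (intro exI[of _ "insert d S4"] exI[of _ T] conjI)
qed

section \<open>A vertex that lies in no copy of \<open>K\<^sub>5\<^sup>-\<close>\<close>

text \<open>
  The classes are the fibres of a colouring \<open>c\<close>. Injectivity of \<open>c\<close> on \<open>e - {v}\<close> says that a
  triple through \<open>v\<close> has its other two vertices in different classes, and that a triple avoiding
  \<open>v\<close> is transversal. The first kind is included and the second excluded, so a single
  equivalence describes all edges.
\<close>

definition uncovering_graph :: "'a set \<Rightarrow> 'a \<Rightarrow> ('a \<Rightarrow> nat) \<Rightarrow> 'a hgraph" where
  "uncovering_graph V v c =
     \<lparr>verts = V, edges = {e \<in> nsets V 3. v \<in> e \<longleftrightarrow> inj_on c (e - {v})}\<rparr>"

lemma three_graph_uncovering_graph: "finite V \<Longrightarrow> three_graph (uncovering_graph V v c)"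
  by (auto simp: three_graph_def uncovering_graph_def)

text \<open>
  A copy of \<open>K\<^sub>5\<^sup>-\<close> on \<open>W\<close> forces every missing triple in \<open>W\<close> to be the same triple \<open>T\<close>. By the
  pigeonhole principle \<open>T\<close> is \<open>{v,x,y}\<close> with \<open>x\<close> and \<open>y\<close> in one class. No other pair can share a
  class, so the three vertices left after deleting \<open>v\<close> and \<open>y\<close> are transversal, hence missing,
  although they differ from \<open>T\<close>.
\<close>

lemma uncovering_graph_not_covering:
  assumes V: "finite V" "v \<in> V" and c: "\<And>x. c x < 3"
  shows "\<not> has_covering (uncovering_graph V v c) K5_minus"
proof
  let ?G = "uncovering_graph V v c"
  assume "has_covering ?G K5_minus"
  moreover have "v \<in> verts ?G" using V(2) by (simp add: uncovering_graph_def)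
  ultimately have "\<exists>H. subgraph H ?G \<and> isomorphic K5_minus H \<and> v \<in> verts H"
    unfolding has_covering_def by (rule bspec)
  then obtain W T where W: "card W = 5" "v \<in> W" and T: "nsets W 3 - {T} \<subseteq> edges ?G"
    unfolding covered_by_K5_minus_iff[OF three_graph_uncovering_graph[OF V(1)]] by (elim exE conjE)
  have finW: "finite W" using W(1) by (simp add: card_ge_0_finite)
  have card4: "card (W - {v}) = 4" using W finW by simp
  have missing: "e = T" if "e \<in> nsets W 3" "(v \<in> e) \<noteq> inj_on c (e - {v})" for e
    using that T by (auto simp: uncovering_graph_def)
  have v_missing: "{v,x,y} = T" if "x \<in> W - {v}" "y \<in> W - {v}" "x \<noteq> y" "c x = c y" for x y
  proof (rule missing)
    show "{v,x,y} \<in> nsets W 3" using that W by (auto simp: nsets_def)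
    have "x \<in> {v,x,y} - {v}" "y \<in> {v,x,y} - {v}" using that by auto
    then have "\<not> inj_on c ({v,x,y} - {v})" using that by (auto dest: inj_onD)
    then show "(v \<in> {v,x,y}) \<noteq> inj_on c ({v,x,y} - {v})" by simp
  qed
  have "card (c ` (W - {v})) \<le> card {..<3::nat}"
    by (rule card_mono) (use c in auto)
  then have "\<not> inj_on c (W - {v})" using pigeonhole[of c "W - {v}"] card4 by simp
  then obtain x y where xy: "x \<in> W - {v}" "y \<in> W - {v}" "x \<noteq> y" "c x = c y"
    by (auto simp: inj_on_def)
  note T_eq = v_missing[OF xy]
  have inj: "inj_on c (W - {v} - {y})"
  proof (rule inj_onI, rule ccontr)
    fix p q assume "p \<in> W - {v} - {y}" "q \<in> W - {v} - {y}" "c p = c q" "p \<noteq> q"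
    then have "{v,p,q} = {v,x,y}" using v_missing[of p q] T_eq by auto
    then show False using \<open>p \<in> W - {v} - {y}\<close> \<open>q \<in> W - {v} - {y}\<close> xy by auto
  qed
  have "W - {v} - {y} = T"
  proof (rule missing)
    show "W - {v} - {y} \<in> nsets W 3" using card4 xy finW by (auto simp: nsets_def)
    show "(v \<in> W - {v} - {y}) \<noteq> inj_on c (W - {v} - {y} - {v})" using inj by (simp add: inj_on_diff)
  qed
  then show False using T_eq by auto
qed

text \<open>
  For every pair a set of at most \<open>m + 2\<close> vertices contains all the non-coneighbours: \<open>v\<close> and the
  class of \<open>y\<close> for the pair \<open>{v,y}\<close>; \<open>v\<close>, \<open>x\<close> and \<open>y\<close> if \<open>x\<close> and \<open>y\<close> share a class; and
  \<open>x\<close>, \<open>y\<close> and the third class otherwise.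
\<close>

lemma min_codegree_uncovering_graph:
  assumes V: "finite V" "v \<in> V" "card V \<ge> 2" and c: "\<And>x. c x < 3"
    and m: "1 \<le> m" "\<And>i. card {x \<in> V - {v}. c x = i} \<le> m"
  shows "card V - (m + 2) \<le> min_codegree (uncovering_graph V v c)"
proof -
  let ?G = "uncovering_graph V v c"
  let ?K = "\<lambda>i. {x \<in> V - {v}. c x = i}"
  have verts: "verts ?G = V" by (simp add: uncovering_graph_def)
  have three: "three_graph ?G" by (rule three_graph_uncovering_graph[OF V(1)])
  have coneighbour: "z \<in> coneighbours ?G {x,y}"
    if "x \<in> V" "y \<in> V" "z \<in> V" "x \<noteq> y" "z \<noteq> x" "z \<noteq> y" "(v \<in> {x,y,z}) = inj_on c ({x,y,z} - {v})"
    for x y z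
  proof -
    have "insert z {x,y} = {x,y,z}" by auto
    moreover have "{x,y,z} \<in> nsets V 3" using that(1-6) by (simp add: nsets_def)
    ultimately show ?thesis using that(7) by (simp add: coneighbours_def uncovering_graph_def del: insert_iff)
  qed
  have at_v: "card V - (m + 2) \<le> codegree ?G v y" if y: "y \<in> V" "y \<noteq> v" for y
  proof -
    have "V - insert v (?K (c y)) \<subseteq> coneighbours ?G {v,y}"
    proof
      fix z assume "z \<in> V - insert v (?K (c y))"
      then have z: "z \<in> V" "z \<noteq> v" "c z \<noteq> c y" by auto
      moreover have "{v,y,z} - {v} = {y,z}" using z y by auto
      ultimately show "z \<in> coneighbours ?G {v,y}"
        using y V(2) by (intro coneighbour) auto
    qed
    then have "card (V - insert v (?K (c y))) \<le> codegree ?G v y"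
      unfolding codegree_eq_card_coneighbours[OF three y(2)[symmetric]]
      using coneighbours_subset[OF three, of "{v,y}"] y V(1) verts
      by (intro card_mono) (auto intro: finite_subset)
    moreover have "card (insert v (?K (c y))) \<le> Suc m"
      using m(2)[of "c y"] V(1) by (simp add: card_insert_if)
    ultimately show ?thesis
      using diff_card_le_card_Diff[of "insert v (?K (c y))" V] V(1) by auto
  qed
  have generic: "card V - (m + 2) \<le> codegree ?G x y"
    if x: "x \<in> V" "x \<noteq> v" and y: "y \<in> V" "y \<noteq> v" and xy: "x \<noteq> y" for x y
  proof -
    obtain B where B: "V - B \<subseteq> coneighbours ?G {x,y}" "card B \<le> m + 2" "finite B"
    proof (cases "c x = c y")
      case True
      have "V - {v,x,y} \<subseteq> coneighbours ?G {x,y}"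
      proof
        fix z assume z: "z \<in> V - {v,x,y}"
        have "{x,y,z} - {v} = {x,y,z}" using x y z by auto
        then show "z \<in> coneighbours ?G {x,y}"
          using x y z xy True by (intro coneighbour) auto
      qed
      moreover have "card {v,x,y} \<le> m + 2" using x y xy m(1) by simp
      ultimately show ?thesis using that by blast
    next
      case False
      \<comment> \<open>The colours sum to \<open>0 + 1 + 2 = 3\<close>, so this is the third one.\<close>
      define i where "i = 3 - c x - c y"
      have other: "j = c x \<or> j = c y" if "j < 3" "j \<noteq> i" for j
        using that False c[of x] c[of y] unfolding i_def by linarith
      have "V - ({x,y} \<union> ?K i) \<subseteq> coneighbours ?G {x,y}"
      proof
        fix z assume z: "z \<in> V - ({x,y} \<union> ?K i)"
        show "z \<in> coneighbours ?G {x,y}"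
        proof (rule coneighbour)
          show "(v \<in> {x,y,z}) = inj_on c ({x,y,z} - {v})"
          proof (cases "z = v")
            case True
            then have "{x,y,z} - {v} = {x,y}" using x y by auto
            then show ?thesis using True False by auto
          next
            case z': False
            have "{x,y,z} - {v} = {x,y,z}" using x y z' by auto
            moreover have "c z = c x \<or> c z = c y" using z z' other[of "c z"] c by auto
            then have "\<not> inj_on c {x,y,z}" using z unfolding inj_on_def by blast
            ultimately show ?thesis using x y z' by simp
          qed
        qed (use x y z xy in auto)
      qed
      moreover have "card ({x,y} \<union> ?K i) \<le> m + 2"
        using card_Un_le[of "{x,y}" "?K i"] m(2)[of i] xy by simp
      ultimately show ?thesis using that V(1) by auto
    qed
    have "card V - card B \<le> card (V - B)" by (rule diff_card_le_card_Diff[OF B(3)])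
    also have "\<dots> \<le> codegree ?G x y"
      unfolding codegree_eq_card_coneighbours[OF three xy]
      using coneighbours_subset[OF three, of "{x,y}"] xy V(1) verts B(1)
      by (intro card_mono) (auto intro: finite_subset)
    finally show ?thesis using B(2) by linarith
  qed
  have sym: "codegree ?G x v = codegree ?G v x" for x
    by (simp add: codegree_def conj_commute)
  show ?thesis
  proof (rule min_codegree_ge)
    fix x y assume "x \<in> verts ?G" "y \<in> verts ?G" "x \<noteq> y"
    then show "card V - (m + 2) \<le> codegree ?G x y"
      using at_v generic sym unfolding verts by metis
  qed (use V verts in auto)
qed

text \<open>
  Vertex \<open>0\<close> is the uncovered one, so the classes divide \<open>{1..n-1}\<close>. Shifting by one cuts this
  interval into \<open>(n + 1) div 3\<close> blocks of at most three consecutive numbers, each of which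
  meets a residue class at most once.
\<close>

lemma card_residue_class_le: "card {x \<in> {..<n} - {0}. x mod 3 = i} \<le> (n + 1) div (3::nat)"
proof -
  let ?K = "{x \<in> {..<n} - {0}. x mod 3 = i}"
  have "inj_on (\<lambda>x. (x - 1) div 3) ?K"
  proof (rule inj_onI)
    fix x y assume "x \<in> ?K" "y \<in> ?K" and div: "(x - 1) div 3 = (y - 1) div 3"
    then obtain a b where ab: "x = Suc a" "y = Suc b" "Suc a mod 3 = Suc b mod 3"
      by (auto simp: gr0_conv_Suc)
    then have "a mod 3 = b mod 3" by (auto simp: mod_Suc split: if_splits)
    moreover have "a div 3 = b div 3" using div ab by simp
    ultimately have "a = b" by (metis div_mult_mod_eq)
    then show "x = y" using ab by simp
  qed
  moreover have "(\<lambda>x. (x - 1) div 3) ` ?K \<subseteq> {..<(n + 1) div 3}"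
  proof (rule image_subsetI)
    fix x assume "x \<in> ?K"
    then obtain a where a: "x = Suc a" "a + 3 \<le> n + 1" by (auto simp: gr0_conv_Suc)
    have "a div 3 < (a + 3) div 3" by simp
    also have "\<dots> \<le> (n + 1) div 3" using a(2) by (rule div_le_mono)
    finally show "(x - 1) div 3 \<in> {..<(n + 1) div 3}" using a(1) by simp
  qed
  ultimately have "card ?K \<le> card {..<(n + 1) div 3}" by (intro card_inj_on_le) auto
  then show ?thesis by simp
qed

theorem exists_uncovered_graph:
  assumes "n \<ge> 2"
  shows "\<exists>G :: nat hgraph. three_graph G \<and> card (verts G) = n \<and> \<not> has_covering G K5_minus \<and>
           2 * n < 3 * min_codegree G + 8"
proof -
  define G where "G = uncovering_graph {..<n} 0 (\<lambda>x::nat. x mod 3)"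
  have "card {..<n} - ((n + 1) div 3 + 2) \<le> min_codegree G"
    unfolding G_def
  proof (rule min_codegree_uncovering_graph)
    show "1 \<le> (n + 1) div 3" using assms by presburger
  qed (use assms card_residue_class_le in auto)
  then have "2 * n < 3 * min_codegree G + 8"
    using assms by simp
  moreover have "\<not> has_covering G K5_minus"
    unfolding G_def using assms by (intro uncovering_graph_not_covering) auto
  moreover have "three_graph G" "card (verts G) = n"
    unfolding G_def by (simp_all add: three_graph_uncovering_graph, simp add: uncovering_graph_def)
  ultimately show ?thesis by blast
qed

section \<open>The covering codegree\<close>

text \<open>
  In integers these are the two bounds \<open>\<lfloor>(2n - 5) / 3\<rfloor> \<le> c\<close> and \<open>c \<le> \<lfloor>(2n - 2) / 3\<rfloor>\<close>: the first
  is equivalent to \<open>(2n - 5) / 3 < c + 1\<close>.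
\<close>

lemma cover_codegree_bounds:
  assumes "n \<ge> 4"
  shows "2 * n < 3 * cover_codegree n K5_minus + 8" "3 * cover_codegree n K5_minus + 2 \<le> 2 * n"
proof -
  define M where "M = {min_codegree G | G :: nat hgraph.
            three_graph G \<and> card (verts G) = n \<and> \<not> has_covering G K5_minus}"
  have c: "cover_codegree n K5_minus = Max M" by (simp add: cover_codegree_def M_def)
  have upper: "3 * m + 2 \<le> 2 * n" if "m \<in> M" for m
    using that has_covering_if_large_min_codegree assms unfolding M_def by (force simp: not_less)
  then have fin: "finite M" by (intro finite_subset[of M "{..n}"]) fastforce+
  obtain m where m: "m \<in> M" "2 * n < 3 * m + 8"
    using exists_uncovered_graph[of n] assms unfolding M_def by auto
  have "m \<le> Max M" using fin m(1) by (rule Max_ge)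
  then show "2 * n < 3 * cover_codegree n K5_minus + 8" using m(2) c by linarith
  show "3 * cover_codegree n K5_minus + 2 \<le> 2 * n"
    using upper Max_in[OF fin] m(1) unfolding c by blast
qed

theorem theorem1p4:
  shows "(\<forall>n::nat. n \<ge> 5 \<longrightarrow>
            \<lfloor>(2 * real n - 5) / 3\<rfloor> \<le> int (cover_codegree n K5_minus) \<and>
            int (cover_codegree n K5_minus) \<le> \<lfloor>(2 * real n - 2) / 3\<rfloor>)
         \<and> convergent (cover_codegree_ratio K5_minus)
         \<and> cover_threshold K5_minus = 2 / 3"
proof -
  have bounds: "2 * real n - 8 < 3 * real (cover_codegree n K5_minus)"
    "3 * real (cover_codegree n K5_minus) \<le> 2 * real n - 2" if "n \<ge> 5" for n
    using cover_codegree_bounds[of n] that by linarith+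
  have "cover_codegree_ratio K5_minus \<longlonglongrightarrow> 2 / 3"
  proof (rule tendsto_sandwich)
    show "\<forall>\<^sub>F n in sequentially.
            (2 * real n - 8) / 3 / (real n - 2) \<le> cover_codegree_ratio K5_minus n"
      using eventually_ge_at_top[of 5]
    proof eventually_elim
      case (elim n)
      show ?case unfolding cover_codegree_ratio_def
        using elim bounds(1)[OF elim] by (intro divide_right_mono) auto
    qed
    show "\<forall>\<^sub>F n in sequentially.
            cover_codegree_ratio K5_minus n \<le> (2 * real n - 2) / 3 / (real n - 2)"
      using eventually_ge_at_top[of 5]
    proof eventually_elim
      case (elim n)
      show ?case unfolding cover_codegree_ratio_def
        using elim bounds(2)[OF elim] by (intro divide_right_mono) auto
    qed
  qed real_asymp+
  then have "convergent (cover_codegree_ratio K5_minus)" "cover_threshold K5_minus = 2 / 3"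
    unfolding cover_threshold_def by (auto simp: convergent_def limI)
  moreover have "\<lfloor>(2 * real n - 5) / 3\<rfloor> \<le> int (cover_codegree n K5_minus) \<and>
            int (cover_codegree n K5_minus) \<le> \<lfloor>(2 * real n - 2) / 3\<rfloor>" if "n \<ge> 5" for n
    using bounds[OF that] by (auto simp: floor_le_iff le_floor_iff)
  ultimately show ?thesis by blast
qed

end
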